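(* Let $\mathcal{V}=\mathbb{C}[x]\oplus\mathbb{C}[y]$, a $\mathbb{Z}_2$-graded vector space with $\mathcal{V}_{\bar 0}=\mathbb{C}[x]$ and $\mathcal{V}_{\bar 1}=\mathbb{C}[y]$. Let $\lambda\in\mathbb{C}^*$ and $\alpha\in\mathbb{C}$. For $m\in\mathbb{Z}$, $r\in\frac12+\mathbb{Z}$, $f(x)\in\mathbb{C}[x]$ and $g(y)\in\mathbb{C}[y]$ define $$L_mf(x)=\lambda^m(x+m\alpha)f(x+m),$$ $$L_mg(y)=\lambda^m\left(y+m(\alpha+\tfrac12)\right)g(y+m),$$ $$G_rf(x)=\lambda^{r-\frac12}f(y+r),$$ $$G_rg(y)=\lambda^{r+\frac12}(x+2r\alpha)g(x+r).$$ Then $\mathcal{V}$ is a module over the Neveu-Schwarz algebra $\mathcal{NS}$ under this action.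
   Context: All spaces are over $\mathbb{C}$; $\mathbb{C}^*$ is the set of nonzero complex numbers. The Neveu-Schwarz algebra $\mathcal{NS}$ (super-Virasoro algebra of Neveu-Schwarz type, without center) is the Lie superalgebra whose even part has basis $\{L_n\mid n\in\mathbb{Z}\}$ and whose odd part has basis $\{G_r\mid r\in\frac12+\mathbb{Z}\}$, with brackets $[L_m,L_n]=(m-n)L_{m+n}$, $[L_m,G_r]=(\frac m2-r)G_{m+r}$, $[G_r,G_s]=2L_{r+s}$ for $m,n\in\mathbb{Z}$, $r,s\in\frac12+\mathbb{Z}$. A module over a Lie superalgebra $A$ always means a supermodule $M=M_{\bar 0}\oplus M_{\bar 1}$ with $A_{\bar i}\cdot M_{\bar j}\subseteq M_{\bar i+\bar j}$. Here $f(y+r)\in\mathbb{C}[y]$ denotes the polynomial obtained from $f$ by substituting $y+r$ for its variable, and similarly for $g(x+r)\in\mathbb{C}[x]$. *)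

theory Defs
  imports Complex_Main
    "HOL-Library.Z2"
    "HOL-Library.Poly_Mapping"
    "HOL-Library.Product_Plus"
    "HOL-Computational_Algebra.Polynomial"
begin

section \<open>Lie superalgebras and their modules\<close>

text \<open>Parities live in \<^typ>\<open>bit\<close>, the integers modulo 2. The sign below is \<open>(-1)\<close> to the
  power \<open>ij\<close>.\<close>

definition super_sign :: "bit \<Rightarrow> bit \<Rightarrow> complex" where
  "super_sign i j = (if i = 1 \<and> j = 1 then -1 else 1)"

locale super_vector_space = vector_space scale
  for scale :: "complex \<Rightarrow> 'a::ab_group_add \<Rightarrow> 'a" +
  fixes part :: "bit \<Rightarrow> 'a set"
  assumes part_subspace: "module.subspace scale (part i)"
    and part_Int: "part 0 \<inter> part 1 = {0}"
    and part_sum: "\<exists>a\<in>part 0. \<exists>b\<in>part 1. v = a + b"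

locale lie_superalgebra = super_vector_space scale part
  for scale :: "complex \<Rightarrow> 'a::ab_group_add \<Rightarrow> 'a" and part :: "bit \<Rightarrow> 'a set" +
  fixes bracket :: "'a \<Rightarrow> 'a \<Rightarrow> 'a"
  assumes bracket_linear_left: "Vector_Spaces.linear scale scale (\<lambda>a. bracket a b)"
    and bracket_linear_right: "Vector_Spaces.linear scale scale (\<lambda>b. bracket a b)"
    and bracket_part: "\<lbrakk>a \<in> part i; b \<in> part j\<rbrakk> \<Longrightarrow> bracket a b \<in> part (i + j)"
    and super_skew_symmetry: "\<lbrakk>a \<in> part i; b \<in> part j\<rbrakk> \<Longrightarrow>
      bracket a b = - scale (super_sign i j) (bracket b a)"
    and super_Jacobi: "\<lbrakk>a \<in> part i; b \<in> part j; c \<in> part k\<rbrakk> \<Longrightarrow>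
      bracket a (bracket b c) =
        bracket (bracket a b) c + scale (super_sign i j) (bracket b (bracket a c))"

locale lie_supermodule =
  alg: lie_superalgebra ascale apart bracket + super_vector_space mscale mpart
  for ascale :: "complex \<Rightarrow> 'a::ab_group_add \<Rightarrow> 'a" and apart :: "bit \<Rightarrow> 'a set"
    and bracket :: "'a \<Rightarrow> 'a \<Rightarrow> 'a"
    and mscale :: "complex \<Rightarrow> 'm::ab_group_add \<Rightarrow> 'm" and mpart :: "bit \<Rightarrow> 'm set" +
  fixes act :: "'a \<Rightarrow> 'm \<Rightarrow> 'm"
  assumes act_linear_left: "Vector_Spaces.linear ascale mscale (\<lambda>a. act a v)"
    and act_linear_right: "Vector_Spaces.linear mscale mscale (\<lambda>v. act a v)"
    and act_part: "\<lbrakk>a \<in> apart i; v \<in> mpart j\<rbrakk> \<Longrightarrow> act a v \<in> mpart (i + j)"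
    and act_bracket: "\<lbrakk>a \<in> apart i; b \<in> apart j\<rbrakk> \<Longrightarrow>
      act (bracket a b) v = act a (act b v) - mscale (super_sign i j) (act b (act a v))"

section \<open>The centreless Neveu--Schwarz algebra\<close>

text \<open>The half-integer \<open>r = k + 1/2\<close> is represented by the integer \<open>k\<close>: \<open>NS_G k\<close> stands for
  \<open>G\<^sub>r\<close> with \<open>r = half_int k\<close>. In particular \<open>G\<close> with index \<open>m + r\<close> is \<open>NS_G (m + k)\<close>, and
  \<open>r + s\<close> is the integer \<open>k + l + 1\<close> when \<open>s = half_int l\<close>.\<close>

datatype ns_gen = NS_L int | NS_G int

definition half_int :: "int \<Rightarrow> complex" where
  "half_int k = of_int k + 1 / 2"

type_synonym ns = "ns_gen \<Rightarrow>\<^sub>0 complex"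

definition ns_scale :: "complex \<Rightarrow> ns \<Rightarrow> ns" where
  "ns_scale c a = Poly_Mapping.map (\<lambda>z. c * z) a"

definition ns_part :: "bit \<Rightarrow> ns set" where
  "ns_part i = {a. Poly_Mapping.keys a \<subseteq> (if i = 0 then range NS_L else range NS_G)}"

text \<open>Linear extension of a map defined on the generators, with values in a space with scalar
  multiplication \<open>s\<close>.\<close>

definition ns_extend :: "(complex \<Rightarrow> 'v \<Rightarrow> 'v) \<Rightarrow> (ns_gen \<Rightarrow> 'v) \<Rightarrow> ns \<Rightarrow> 'v::comm_monoid_add"
  where "ns_extend s f a = (\<Sum>e\<in>Poly_Mapping.keys a. s (Poly_Mapping.lookup a e) (f e))"

fun ns_gen_bracket :: "ns_gen \<Rightarrow> ns_gen \<Rightarrow> ns" where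
  "ns_gen_bracket (NS_L m) (NS_L n) = Poly_Mapping.single (NS_L (m + n)) (of_int m - of_int n)"
| "ns_gen_bracket (NS_L m) (NS_G k) =
    Poly_Mapping.single (NS_G (m + k)) (of_int m / 2 - half_int k)"
| "ns_gen_bracket (NS_G k) (NS_L m) =
    - Poly_Mapping.single (NS_G (m + k)) (of_int m / 2 - half_int k)"
| "ns_gen_bracket (NS_G k) (NS_G l) = Poly_Mapping.single (NS_L (k + l + 1)) 2"

definition ns_bracket :: "ns \<Rightarrow> ns \<Rightarrow> ns" where
  "ns_bracket a b = ns_extend ns_scale (\<lambda>d. ns_extend ns_scale (\<lambda>e. ns_gen_bracket d e) b) a"

section \<open>The space of pairs of polynomials and the action\<close>

text \<open>A pair \<open>(f, g)\<close> stands for the sum of \<open>f\<close>, a polynomial in \<open>x\<close>, and \<open>g\<close>, a polynomial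
  in \<open>y\<close>.\<close>

type_synonym polys = "complex poly \<times> complex poly"

definition polys_scale :: "complex \<Rightarrow> polys \<Rightarrow> polys" where
  "polys_scale c v = (smult c (fst v), smult c (snd v))"

definition polys_part :: "bit \<Rightarrow> polys set" where
  "polys_part i = (if i = 0 then UNIV \<times> {0} else {0} \<times> UNIV)"

definition poly_translate :: "complex poly \<Rightarrow> complex \<Rightarrow> complex poly" where
  "poly_translate f c = pcompose f [:c, 1:]"

text \<open>For \<open>r = half_int k\<close> the exponents \<open>r - 1/2\<close> and \<open>r + 1/2\<close> of \<open>\<lambda>\<close> are the integers
  \<open>k\<close> and \<open>k + 1\<close>. The factor \<open>x + c\<close> is the polynomial \<open>[:c, 1:]\<close>.\<close>

fun ns_gen_act :: "complex \<Rightarrow> complex \<Rightarrow> ns_gen \<Rightarrow> polys \<Rightarrow> polys" where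
  "ns_gen_act lam \<alpha> (NS_L m) (f, g) =
    (smult (lam powi m) ([:of_int m * \<alpha>, 1:] * poly_translate f (of_int m)),
     smult (lam powi m) ([:of_int m * (\<alpha> + 1 / 2), 1:] * poly_translate g (of_int m)))"
| "ns_gen_act lam \<alpha> (NS_G k) (f, g) =
    (smult (lam powi (k + 1)) ([:2 * half_int k * \<alpha>, 1:] * poly_translate g (half_int k)),
     smult (lam powi k) (poly_translate f (half_int k)))"

definition ns_act :: "complex \<Rightarrow> complex \<Rightarrow> ns \<Rightarrow> polys \<Rightarrow> polys" where
  "ns_act lam \<alpha> a v = ns_extend polys_scale (\<lambda>e. ns_gen_act lam \<alpha> e v) a"

end

theory Submission
  imports Defs
begin

text \<open>Every homogeneous element of the algebra is a sum of scaled generators of the same parity, so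
  all identities reduce by multilinearity to identities between generators. For the action these
  are compared by evaluating both components at a point: the composites of two generators in either
  order, and the action of their bracket, share the same power of \<open>\<lambda>\<close> and the same translate of
  \<open>f\<close> or \<open>g\<close>, so only a polynomial identity between the linear factors remains.\<close>

section \<open>Parity of generators and the two vector spaces\<close>

fun ns_parity :: "ns_gen \<Rightarrow> bit" where
  "ns_parity (NS_L m) = 0"
| "ns_parity (NS_G k) = 1"

lemma ns_parity_eq_iff: "ns_parity e = i \<longleftrightarrow> e \<in> (if i = 0 then range NS_L else range NS_G)"
  by (cases e) auto

lemma ns_part_iff: "a \<in> ns_part i \<longleftrightarrow> (\<forall>e\<in>Poly_Mapping.keys a. ns_parity e = i)"
  by (auto simp: ns_part_def ns_parity_eq_iff)

lemma single_in_ns_part: "ns_parity e = i \<Longrightarrow> Poly_Mapping.single e c \<in> ns_part i"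
  by (simp add: ns_part_iff)

lemma lookup_ns_scale [simp]: "Poly_Mapping.lookup (ns_scale c a) e = c * Poly_Mapping.lookup a e"
  by (simp add: ns_scale_def Poly_Mapping.map.rep_eq when_def)

lemma ns_scale_single [simp]:
  "ns_scale c (Poly_Mapping.single e d) = Poly_Mapping.single e (c * d)"
  by (rule poly_mapping_eqI) (simp add: lookup_single when_def)

text \<open>A common home for the facts about \<open>ns_extend\<close>: the interpretation for the
  algebra serves the bracket, the one for pairs of polynomials serves the action.\<close>

locale complex_vector_space = vector_space scale
  for scale :: "complex \<Rightarrow> 'v::ab_group_add \<Rightarrow> 'v"

interpretation ns: complex_vector_space ns_scale
  by unfold_locales (auto intro!: poly_mapping_eqI simp: lookup_add algebra_simps)

interpretation polys: complex_vector_space polys_scale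
  by unfold_locales (auto simp: polys_scale_def smult_add_left smult_add_right)

text \<open>An element is the finite sum of its terms over its support, and homogeneity forces every
  generator in the support to have parity \<open>i\<close>. This is the form in which multilinearity
  is used below.\<close>

lemma ns_part_induct [consumes 1, case_names zero add single]:
  assumes "a \<in> ns_part i"
    and "P 0"
    and "\<And>a b. P a \<Longrightarrow> P b \<Longrightarrow> P (a + b)"
    and "\<And>e c. ns_parity e = i \<Longrightarrow> P (Poly_Mapping.single e c)"
  shows "P a"
proof -
  \<comment> \<open>Partial sums over subsets of the support let a finite set induction run; the
    whole support gives back \<open>a\<close>.\<close>
  have "P (\<Sum>e\<in>S. Poly_Mapping.single e (Poly_Mapping.lookup a e))"
    if "S \<subseteq> Poly_Mapping.keys a" for S
    using finite_subset[OF that finite_keys] that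
  proof (induction S rule: finite_induct)
    case (insert e S)
    then show ?case
      using assms(1) by (auto simp: ns_part_iff intro!: assms(3,4))
  qed (simp add: assms(2))
  moreover have "(\<Sum>e\<in>Poly_Mapping.keys a. Poly_Mapping.single e (Poly_Mapping.lookup a e)) = a"
    by (rule poly_mapping_eqI)
      (auto simp: lookup_sum lookup_single when_def in_keys_iff)
  ultimately show ?thesis
    by (metis order_refl)
qed

section \<open>Linear extension from the generators\<close>

lemma linearI:
  assumes "vector_space s" "vector_space t"
    and "\<And>v w. f (v + w) = f v + f w" "\<And>c v. f (s c v) = t c (f v)"
  shows "Vector_Spaces.linear s t f"
  using assms
  by (auto simp: Vector_Spaces.linear_def module_hom_def module_hom_axioms_def
      vector_space_def module_def)

context complex_vector_space
begin

text \<open>Coefficients off the support are 0, so extra indices contribute nothing. This allows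
  extensions of elements with different supports to be compared over one index set.\<close>

lemma ns_extend_superset:
  assumes "finite S" "Poly_Mapping.keys a \<subseteq> S"
  shows "ns_extend scale f a = (\<Sum>e\<in>S. scale (Poly_Mapping.lookup a e) (f e))"
  unfolding ns_extend_def using assms by (intro sum.mono_neutral_left) (auto simp: in_keys_iff)

lemma ns_extend_zero [simp]: "ns_extend scale f 0 = 0"
  by (simp add: ns_extend_def)

lemma ns_extend_add: "ns_extend scale f (a + b) = ns_extend scale f a + ns_extend scale f b"
proof -
  \<comment> \<open>Cancellation may shrink the support of \<open>a + b\<close>, but it stays inside
    this union.\<close>
  let ?S = "Poly_Mapping.keys a \<union> Poly_Mapping.keys b"
  show ?thesis
    using Poly_Mapping.keys_add[of a b]
    by (simp add: ns_extend_superset[of ?S] lookup_add scale_left_distrib sum.distrib)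
qed

lemma ns_extend_scale: "ns_extend scale f (ns_scale c a) = scale c (ns_extend scale f a)"
proof -
  \<comment> \<open>Only an inclusion, since \<open>c = 0\<close> empties the support.\<close>
  have "Poly_Mapping.keys (ns_scale c a) \<subseteq> Poly_Mapping.keys a"
    by (auto simp: in_keys_iff)
  then show ?thesis
    by (simp add: ns_extend_superset[of "Poly_Mapping.keys a"] scale_sum_right)
qed

lemma ns_extend_single [simp]: "ns_extend scale f (Poly_Mapping.single e c) = scale c (f e)"
  by (simp add: ns_extend_superset[of "{e}"])

lemma linear_ns_extend: "Vector_Spaces.linear ns_scale scale (ns_extend scale f)"
  by (intro linearI ns_extend_add ns_extend_scale ns.vector_space_axioms vector_space_axioms)

text \<open>The second argument of the bracket and the vector acted upon enter only through the
  values on generators; this and the next fact give linearity in them.\<close>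

lemma ns_extend_fun_add:
  "ns_extend scale (\<lambda>e. f e + g e) a = ns_extend scale f a + ns_extend scale g a"
  by (simp add: ns_extend_def scale_right_distrib sum.distrib)

lemma ns_extend_fun_scale: "ns_extend scale (\<lambda>e. scale c (f e)) a = scale c (ns_extend scale f a)"
  by (simp add: ns_extend_def scale_sum_right mult.commute)

end

section \<open>The Lie superalgebra axioms\<close>

lemma ns_bracket_add_left: "ns_bracket (a + b) c = ns_bracket a c + ns_bracket b c"
  by (simp add: ns_bracket_def ns.ns_extend_add)

lemma ns_bracket_add_right: "ns_bracket a (b + c) = ns_bracket a b + ns_bracket a c"
  by (simp add: ns_bracket_def ns.ns_extend_add ns.ns_extend_fun_add)

lemma ns_bracket_zero [simp]: "ns_bracket 0 a = 0" "ns_bracket a 0 = 0"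
  by (simp_all add: ns_bracket_def) (simp add: ns_extend_def)

lemma ns_bracket_single:
  "ns_bracket (Poly_Mapping.single d p) (Poly_Mapping.single e q) =
    ns_scale (p * q) (ns_gen_bracket d e)"
  by (simp add: ns_bracket_def)

lemma ns_part_subspace: "ns.subspace (ns_part i)"
proof (rule ns.subspaceI)
  show "0 \<in> ns_part i"
    by (simp add: ns_part_iff)
  show "a + b \<in> ns_part i" if "a \<in> ns_part i" "b \<in> ns_part i" for a b
    using that Poly_Mapping.keys_add[of a b] by (auto simp: ns_part_iff)
  show "ns_scale c a \<in> ns_part i" if "a \<in> ns_part i" for c a
    using that by (auto simp: ns_part_iff in_keys_iff)
qed

lemma ns_gen_bracket_part: "ns_gen_bracket d e \<in> ns_part (ns_parity d + ns_parity e)"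
  by (cases d; cases e)
    (auto intro!: single_in_ns_part ns.subspace_neg ns_part_subspace simp del: single_uminus)

lemma ns_gen_bracket_skew:
  "ns_gen_bracket d e = - ns_scale (super_sign (ns_parity d) (ns_parity e)) (ns_gen_bracket e d)"
  by (cases d; cases e) (simp_all add: super_sign_def single_uminus[symmetric] add_ac)

text \<open>In each of the eight cases all terms are multiples of the same generator, whose index is
  the sum of the three indices, plus 1 as soon as two of the generators are odd. What remains is an
  equation between coefficients.\<close>

lemma ns_Jacobi_single:
  fixes d e f :: ns_gen and p q r :: complex
  defines "a \<equiv> Poly_Mapping.single d p" and "b \<equiv> Poly_Mapping.single e q"
    and "c \<equiv> Poly_Mapping.single f r"
  shows "ns_bracket a (ns_bracket b c) =
    ns_bracket (ns_bracket a b) c +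
      ns_scale (super_sign (ns_parity d) (ns_parity e)) (ns_bracket b (ns_bracket a c))"
  unfolding a_def b_def c_def
  by (cases d; cases e; cases f)
    (simp_all add: ns_bracket_single super_sign_def half_int_def add_ac
      single_add[symmetric] single_uminus[symmetric],
      auto intro!: arg_cong[where f = "Poly_Mapping.single _"] simp: field_simps)

lemma ns_bracket_part:
  assumes "a \<in> ns_part i" "b \<in> ns_part j"
  shows "ns_bracket a b \<in> ns_part (i + j)"
  using assms
proof (induction a rule: ns_part_induct)
  case (add a b)
  then show ?case
    by (simp add: ns_bracket_add_left ns.subspace_add[OF ns_part_subspace])
next
  case (single d p)
  note d = single.hyps
  from single.prems show ?case
  proof (induction b rule: ns_part_induct)
    case (add a b)
    then show ?case
      by (simp add: ns_bracket_add_right ns.subspace_add[OF ns_part_subspace])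
  next
    case (single e q)
    then show ?case
      using d ns_gen_bracket_part[of d e]
      by (auto simp: ns_bracket_single intro!: ns.subspace_scale[OF ns_part_subspace])
  qed (simp add: ns.subspace_0[OF ns_part_subspace])
qed (simp add: ns.subspace_0[OF ns_part_subspace])

lemma ns_super_skew_symmetry:
  assumes "a \<in> ns_part i" "b \<in> ns_part j"
  shows "ns_bracket a b = - ns_scale (super_sign i j) (ns_bracket b a)"
  using assms
proof (induction a rule: ns_part_induct)
  case (add a b)
  then show ?case
    by (simp add: ns_bracket_add_left ns_bracket_add_right ns.scale_right_distrib)
next
  case (single d p)
  note d = single.hyps
  from single.prems show ?case
  proof (induction b rule: ns_part_induct)
    case (add a b)
    then show ?case
      by (simp add: ns_bracket_add_left ns_bracket_add_right ns.scale_right_distrib)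
  next
    case (single e q)
    then show ?case
      using d ns_gen_bracket_skew[of d e]
      by (simp add: ns_bracket_single mult_ac flip: ns.scale_minus_right)
  qed simp
qed simp

lemma ns_super_Jacobi:
  assumes "a \<in> ns_part i" "b \<in> ns_part j" "c \<in> ns_part k"
  shows "ns_bracket a (ns_bracket b c) =
    ns_bracket (ns_bracket a b) c + ns_scale (super_sign i j) (ns_bracket b (ns_bracket a c))"
  using assms
proof (induction a rule: ns_part_induct)
  case (single d p)
  note d = single.hyps
  from single.prems show ?case
  proof (induction b rule: ns_part_induct)
    case (single e q)
    note e = single.hyps
    from single.prems show ?case
    proof (induction c rule: ns_part_induct)
      case (single f r)
      then show ?case
        using d e ns_Jacobi_single by blast
    qed (simp_all add: ns_bracket_add_right ns.scale_right_distrib)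
  qed (simp_all add: ns_bracket_add_left ns_bracket_add_right ns.scale_right_distrib)
qed (simp_all add: ns_bracket_add_left ns_bracket_add_right ns.scale_right_distrib)

lemma ns_part_sum: "\<exists>a\<in>ns_part 0. \<exists>b\<in>ns_part 1. v = a + b"
proof -
  \<comment> \<open>The terms of \<open>v\<close> are sorted by parity; as every generator has
    parity 0 or 1, the two sums exhaust the support.\<close>
  define f where "f i = (\<Sum>e\<in>{e \<in> Poly_Mapping.keys v. ns_parity e = i}.
    Poly_Mapping.single e (Poly_Mapping.lookup v e))" for i
  have "f i \<in> ns_part i" for i
    unfolding f_def by (rule ns.subspace_sum[OF ns_part_subspace]) (simp add: single_in_ns_part)
  moreover have "v = f 0 + f 1"
    by (rule poly_mapping_eqI)
      (auto simp: f_def lookup_add lookup_sum lookup_single when_def in_keys_iff sum.delta)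
  ultimately show ?thesis
    by blast
qed

lemma ns_lie_superalgebra: "lie_superalgebra ns_scale ns_part ns_bracket"
proof (intro lie_superalgebra.intro super_vector_space.intro super_vector_space_axioms.intro
    lie_superalgebra_axioms.intro ns.vector_space_axioms)
  show "ns.subspace (ns_part i)" for i
    by (rule ns_part_subspace)
  show "ns_part 0 \<inter> ns_part 1 = {0}"
    by (auto simp: ns_part_iff simp flip: keys_eq_empty)
  show "\<exists>a\<in>ns_part 0. \<exists>b\<in>ns_part 1. v = a + b" for v
    by (rule ns_part_sum)
  show "Vector_Spaces.linear ns_scale ns_scale (\<lambda>a. ns_bracket a b)" for b
    unfolding ns_bracket_def by (rule ns.linear_ns_extend)
  \<comment> \<open>The second argument sits in the inner extension, so scalars pass first through
    that extension and then through the generator values of the outer one.\<close>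
  show "Vector_Spaces.linear ns_scale ns_scale (\<lambda>b. ns_bracket a b)" for a
    by (intro linearI ns.vector_space_axioms ns_bracket_add_right)
      (simp add: ns_bracket_def ns.ns_extend_scale ns.ns_extend_fun_scale)
qed (fact ns_bracket_part ns_super_skew_symmetry ns_super_Jacobi)+

section \<open>The action on pairs of polynomials\<close>

lemma poly_poly_translate [simp]: "poly (poly_translate f c) x = poly f (x + c)"
  by (simp add: poly_translate_def poly_pcompose add.commute)

text \<open>A complex polynomial is determined by its values, so translations become shifts of the
  evaluation point and identities become field arithmetic.\<close>

lemma polys_eqI:
  fixes v w :: polys
  assumes "\<And>x. poly (fst v) x = poly (fst w) x" "\<And>x. poly (snd v) x = poly (snd w) x"
  shows "v = w"
proof -
  have "poly (fst v) = poly (fst w)" "poly (snd v) = poly (snd w)"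
    using assms by auto
  then show ?thesis
    by (simp add: prod_eq_iff poly_eq_poly_eq_iff)
qed

lemma ns_gen_act_add: "ns_gen_act lam \<alpha> e (v + w) = ns_gen_act lam \<alpha> e v + ns_gen_act lam \<alpha> e w"
  by (rule polys_eqI; cases e; cases v; cases w) (simp_all add: algebra_simps)

lemma ns_gen_act_scale:
  "ns_gen_act lam \<alpha> e (polys_scale c v) = polys_scale c (ns_gen_act lam \<alpha> e v)"
  by (rule polys_eqI; cases e; cases v) (simp_all add: polys_scale_def algebra_simps)

lemma ns_act_single: "ns_act lam \<alpha> (Poly_Mapping.single e c) v = polys_scale c (ns_gen_act lam \<alpha> e v)"
  by (simp add: ns_act_def)

lemma ns_act_zero [simp]: "ns_act lam \<alpha> 0 v = 0"
  by (simp add: ns_act_def)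

lemma ns_act_add_left: "ns_act lam \<alpha> (a + b) v = ns_act lam \<alpha> a v + ns_act lam \<alpha> b v"
  by (simp add: ns_act_def polys.ns_extend_add)

lemma ns_act_scale_left: "ns_act lam \<alpha> (ns_scale c a) v = polys_scale c (ns_act lam \<alpha> a v)"
  by (simp add: ns_act_def polys.ns_extend_scale)

lemma ns_act_add_right: "ns_act lam \<alpha> a (v + w) = ns_act lam \<alpha> a v + ns_act lam \<alpha> a w"
  by (simp add: ns_act_def ns_gen_act_add polys.ns_extend_fun_add)

lemma ns_act_scale_right: "ns_act lam \<alpha> a (polys_scale c v) = polys_scale c (ns_act lam \<alpha> a v)"
  by (simp add: ns_act_def ns_gen_act_scale polys.ns_extend_fun_scale)

lemma ns_act_zero_right [simp]: "ns_act lam \<alpha> a 0 = 0"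
  using ns_act_scale_right[of lam \<alpha> a 0 0] by simp

text \<open>\<open>lam \<noteq> 0\<close> makes integer powers multiplicative, even for opposite
  exponents. For two odd generators with half-integers \<open>r\<close> and \<open>s\<close> the
  factors on \<open>f\<close> add up to \<open>2 * (x + (r + s) * \<alpha>)\<close>. On
  \<open>g\<close> they are \<open>y + r + 2 * s * \<alpha>\<close> and
  \<open>y + s + 2 * r * \<alpha>\<close>, with sum
  \<open>2 * (y + (r + s) * (\<alpha> + 1 / 2))\<close>; this accounts for the shift of
  \<open>\<alpha>\<close> by \<open>1 / 2\<close> on the odd part.\<close>

lemma ns_gen_act_bracket:
  assumes "lam \<noteq> 0"
  shows "ns_act lam \<alpha> (ns_gen_bracket d e) v =
    ns_gen_act lam \<alpha> d (ns_gen_act lam \<alpha> e v) -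
      polys_scale (super_sign (ns_parity d) (ns_parity e))
        (ns_gen_act lam \<alpha> e (ns_gen_act lam \<alpha> d v))"
proof (cases v)
  case (Pair f g)
  show ?thesis
    unfolding Pair
    by (rule polys_eqI; cases d; cases e)
      (simp_all add: ns_act_single polys_scale_def super_sign_def assms power_int_add
        single_uminus[symmetric] half_int_def add_ac del: single_uminus, simp_all add: field_simps)
qed

lemma polys_part_subspace: "polys.subspace (polys_part i)"
  by (rule polys.subspaceI) (auto simp: polys_part_def polys_scale_def zero_prod_def)

text \<open>\<open>NS_L\<close> acts on each component separately and \<open>NS_G\<close> exchanges
  them; a zero component stays zero under translation and multiplication.\<close>

lemma ns_gen_act_part:
  "v \<in> polys_part j \<Longrightarrow> ns_gen_act lam \<alpha> e v \<in> polys_part (ns_parity e + j)"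
  by (cases v; cases e; cases j) (auto simp: polys_part_def poly_translate_def)

lemma ns_act_part:
  assumes "a \<in> ns_part i" "v \<in> polys_part j"
  shows "ns_act lam \<alpha> a v \<in> polys_part (i + j)"
  using assms(1)
proof (induction a rule: ns_part_induct)
  case (single e c)
  show ?case
    unfolding single.hyps[symmetric] ns_act_single
    by (intro polys.subspace_scale[OF polys_part_subspace] ns_gen_act_part assms(2))
qed (simp_all add: ns_act_add_left polys.subspace_0[OF polys_part_subspace]
    polys.subspace_add[OF polys_part_subspace])

text \<open>Both sides are additive in \<open>a\<close> and in \<open>b\<close>, so two nested
  inductions reduce to generators. The vector \<open>v\<close> stays arbitrary, because the identity
  for generators holds on every pair.\<close>

lemma ns_act_bracket:
  assumes "lam \<noteq> 0" "a \<in> ns_part i" "b \<in> ns_part j"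
  shows "ns_act lam \<alpha> (ns_bracket a b) v =
    ns_act lam \<alpha> a (ns_act lam \<alpha> b v) -
      polys_scale (super_sign i j) (ns_act lam \<alpha> b (ns_act lam \<alpha> a v))"
  using assms(2,3)
proof (induction a rule: ns_part_induct)
  case (single d p)
  note d = single.hyps
  from single.prems show ?case
  proof (induction b rule: ns_part_induct)
    case (single e q)
    then show ?case
      using d by (auto simp: ns_bracket_single ns_act_single ns_act_scale_left ns_gen_act_scale
          ns_gen_act_bracket[OF assms(1)] polys.scale_right_diff_distrib mult_ac)
  qed (simp_all add: ns_bracket_add_right ns_act_add_left ns_act_add_right
      polys.scale_right_distrib)
qed (simp_all add: ns_bracket_add_left ns_act_add_left ns_act_add_right
    polys.scale_right_distrib)

theorem proposition2p8:
  fixes lam \<alpha> :: complex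
  assumes "lam \<noteq> 0"
  shows "lie_supermodule ns_scale ns_part ns_bracket polys_scale polys_part (ns_act lam \<alpha>)"
proof (intro lie_supermodule.intro super_vector_space.intro super_vector_space_axioms.intro
    lie_supermodule_axioms.intro ns_lie_superalgebra polys.vector_space_axioms)
  show "polys.subspace (polys_part i)" for i
    by (rule polys_part_subspace)
  show "polys_part 0 \<inter> polys_part 1 = {0}"
    by (auto simp: polys_part_def zero_prod_def)
  show "\<exists>a\<in>polys_part 0. \<exists>b\<in>polys_part 1. v = a + b" for v
    by (cases v) (simp add: polys_part_def)
  show "Vector_Spaces.linear ns_scale polys_scale (\<lambda>a. ns_act lam \<alpha> a v)" for v
    by (intro linearI ns.vector_space_axioms polys.vector_space_axioms
        ns_act_add_left ns_act_scale_left)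
  show "Vector_Spaces.linear polys_scale polys_scale (\<lambda>v. ns_act lam \<alpha> a v)" for a
    by (intro linearI polys.vector_space_axioms ns_act_add_right ns_act_scale_right)
qed (fact ns_act_part ns_act_bracket[OF assms])+

end
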